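(* Let $\mathcal{O}_{\mathrm{for}}$, $r$, $c$ and the parameter sets $\Theta,\Phi$ be as defined in the context. For any set $\Psi$ of permissible values of the partial-encoder parameter $\psi$, and for any $\theta\in\Theta$ and $\phi\in\Phi$, $$\operatorname*{arg\,max}_{\psi\in\Psi}\ \mathcal{O}_{\mathrm{for}}(\theta,\phi,\psi)\;=\;\operatorname*{arg\,min}_{\psi\in\Psi}\ \mathbb{E}_{p_{\mathrm{data}}(\mathbf{y})}\Big[\mathrm{KL}\big(r(\mathbf{z}\mid\mathbf{y};\phi)\,\big\|\,c(\mathbf{z}\mid\mathbf{y};\psi)\big)\Big].$$
   Context: Setting. $p_{\mathrm{data}}(\mathbf{x},\mathbf{y})$ is a joint distribution of data $\mathbf{x}$ and a conditioning input $\mathbf{y}$; its marginals and conditionals are also written $p_{\mathrm{data}}$. A variational auto-encoder (VAE) consists of: a prior $p_{\mathrm{model}}(\mathbf{z};\theta)$ over latent variables $\mathbf{z}$ and a decoder $p_{\mathrm{model}}(\mathbf{x}\mid\mathbf{z};\theta)$, with parameters $\theta\in\Theta$; and an encoder $q(\mathbf{z}\mid\mathbf{x};\phi)$, a distribution over $\mathbf{z}$ given $\mathbf{x}$, with parameters $\phi\in\Phi$. A partial encoder $c(\mathbf{z}\mid\mathbf{y};\psi)$ is a family of conditional distributions over $\mathbf{z}$ given $\mathbf{y}$, with parameters $\psi\in\Psi$. Distributions are written through their densities (or mass functions). Define the joint distribution $$r(\mathbf{z},\mathbf{x},\mathbf{y};\phi)=p_{\mathrm{data}}(\mathbf{x},\mathbf{y})\,q(\mathbf{z}\mid\mathbf{x};\phi).$$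 The symbol $r$ also denotes any marginals and conditionals of this joint distribution; in particular $r(\mathbf{z}\mid\mathbf{y};\phi)$ is the conditional of $\mathbf{z}$ given $\mathbf{y}$ under $r$, with $\mathbf{x}$ marginalised out. $\tilde{\mathbf{x}}$ denotes the part of $\mathbf{x}$ to be predicted; it is a deterministic function of $(\mathbf{x},\mathbf{y})$: either $\tilde{\mathbf{x}}=\mathbf{x}$, or (for inpainting, where $\mathbf{y}$ is an image with some pixels masked out) the dimensions of $\mathbf{x}$ not observed in $\mathbf{y}$. $p_{\mathrm{model}}(\tilde{\mathbf{x}}\mid\mathbf{z};\theta)$ is the corresponding likelihood of $\tilde{\mathbf{x}}$ given $\mathbf{z}$ under the decoder (equal to the decoder itself when $\tilde{\mathbf{x}}=\mathbf{x}$; the decoder likelihood is pixel-wise independent given $\mathbf{z}$). The training objective is $$\mathcal{O}_{\mathrm{for}}(\theta,\phi,\psi)=\mathbb{E}_{p_{\mathrm{data}}(\mathbf{x},\mathbf{y})}\,\mathbb{E}_{q(\mathbf{z}\mid\mathbf{x};\phi)}\left[\log\frac{p_{\mathrm{model}}(\tilde{\mathbf{x}}\mid\mathbf{z};\theta)\,c(\mathbf{z}\mid\mathbf{y};\psi)}{q(\mathbf{z}\mid\mathbf{x};\phi)}\right].$$ $\mathrm{KL}(p\,\|\,p')=\mathbb{E}_{p}[\log(p/p')]$ is the Kullback–Leibler divergence.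
   Formalization: It is additionally assumed that log(p_model(x̃|z;θ) r(z|y;φ)/q(z|x;φ)) is absolutely integrable under r; otherwise the objective may be −∞ for every ψ while the KL terms differ, and the equality fails. *)

theory Defs
  imports "HOL-Probability.Probability"
begin

text \<open>
  The library's \<^const>\<open>ln\<close> and \<^const>\<open>KL_divergence\<close> are real-valued: \<^term>\<open>ln (0::real)\<close> is \<open>0\<close>,
  and a divergence that is infinite comes out as \<open>0\<close>.  An optimisation over an
  arbitrary family of partial encoders has to see the values \<open>\<plusminus>\<infinity>\<close>, so logarithms, expectations
  and the divergence are taken in the extended reals here.
\<close>

definition eln :: "ennreal \<Rightarrow> ereal" where
  "eln t = (if t = 0 then - \<infinity> else if t = \<infinity> then \<infinity> else ereal (ln (enn2real t)))"

text \<open>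
  \<^const>\<open>e2ennreal\<close> sends negative numbers to \<open>0\<close>, so the two integrals are those of the positive
  and the negative part.  Note that \<open>\<infinity> - \<infinity> = \<infinity>\<close> in \<^typ>\<open>ereal\<close>, so the value is meaningful only
  if one of the two integrals is finite.
\<close>

definition expect :: "'a measure \<Rightarrow> ('a \<Rightarrow> ereal) \<Rightarrow> ereal" where
  "expect M f =
     enn2ereal (\<integral>\<^sup>+ x. e2ennreal (f x) \<partial>M) - enn2ereal (\<integral>\<^sup>+ x. e2ennreal (- f x) \<partial>M)"

definition abs_integrable :: "'a measure \<Rightarrow> ('a \<Rightarrow> ereal) \<Rightarrow> bool" where
  "abs_integrable M f \<longleftrightarrow>
     f \<in> borel_measurable M \<and> (\<integral>\<^sup>+ x. e2ennreal \<bar>f x\<bar> \<partial>M) < \<infinity>"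

definition KL :: "'a measure \<Rightarrow> ('a \<Rightarrow> ennreal) \<Rightarrow> ('a \<Rightarrow> ennreal) \<Rightarrow> ereal" where
  "KL M p p' = expect (density M p) (\<lambda>x. eln (p x / p' x))"

definition prob_density :: "'a measure \<Rightarrow> ('a \<Rightarrow> ennreal) \<Rightarrow> bool" where
  "prob_density M f \<longleftrightarrow> f \<in> borel_measurable M \<and> (\<integral>\<^sup>+ x. f x \<partial>M) = 1"

text \<open>\<open>k a b\<close> is the density at \<open>b\<close>, with respect to \<open>N\<close>, of a distribution given \<open>a\<close>.\<close>

definition cond_density :: "'a measure \<Rightarrow> 'b measure \<Rightarrow> ('a \<Rightarrow> 'b \<Rightarrow> ennreal) \<Rightarrow> bool" where
  "cond_density M N k \<longleftrightarrow>
     (\<lambda>(a, b). k a b) \<in> borel_measurable (M \<Otimes>\<^sub>M N) \<and>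
     (\<forall>a\<in>space M. (\<integral>\<^sup>+ b. k a b \<partial>N) = 1)"

text \<open>
  Densities over \<open>x\<close> and \<open>z\<close> are with respect to \<open>MX\<close> and \<open>MZ\<close> (Lebesgue, counting, \<dots>).
  The data distribution is a probability measure and need not have a density with respect to a
  product measure: for inpainting \<open>y\<close> is a masked copy of \<open>x\<close>, so with continuous pixels
  there is none.

  The function \<open>xt\<close> maps \<open>(x, y)\<close> to the part of \<open>x\<close> to be predicted, and \<open>lik \<theta> z\<close> is the density
  of that part under the decoder.  Its reference measure \<open>ref y\<close> may depend on \<open>y\<close>, since
  \<open>y\<close> determines which coordinates of \<open>x\<close> are missing.  If all of \<open>x\<close> is predicted, then
  \<open>xt = fst\<close>, \<open>ref y = MX\<close> and \<open>lik = dec\<close>.  For inpainting with a decoder that is a product over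
  pixels, \<open>ref y\<close> is the product measure over the pixels missing from \<open>y\<close>, and \<open>lik\<close> is the product
  of the decoder's factors at those pixels.
\<close>

locale cond_vae =
  fixes MX :: "'x measure" and MY :: "'y measure" and MZ :: "'z measure"
    and MT :: "'t measure" and ref :: "'y \<Rightarrow> 't measure"
    and \<Theta> :: "'th set" and \<Phi> :: "'ph set"
    and pdata :: "('x \<times> 'y) measure"
    and prior :: "'th \<Rightarrow> 'z \<Rightarrow> ennreal"
    and dec :: "'th \<Rightarrow> 'z \<Rightarrow> 'x \<Rightarrow> ennreal"
    and q :: "'ph \<Rightarrow> 'x \<Rightarrow> 'z \<Rightarrow> ennreal"
    and xt :: "'x \<times> 'y \<Rightarrow> 't"
    and lik :: "'th \<Rightarrow> 'z \<Rightarrow> 't \<Rightarrow> ennreal"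
  assumes sigma_finite_MZ: "sigma_finite_measure MZ"
    and prob_pdata: "prob_space pdata"
    and sets_pdata: "sets pdata = sets (MX \<Otimes>\<^sub>M MY)"
    and prior: "\<theta> \<in> \<Theta> \<Longrightarrow> prob_density MZ (prior \<theta>)"
    and decoder: "\<theta> \<in> \<Theta> \<Longrightarrow> cond_density MZ MX (dec \<theta>)"
    and encoder: "\<phi> \<in> \<Phi> \<Longrightarrow> cond_density MX MZ (q \<phi>)"
    and xt_measurable: "xt \<in> MX \<Otimes>\<^sub>M MY \<rightarrow>\<^sub>M MT"
    and lik_measurable: "\<theta> \<in> \<Theta> \<Longrightarrow> (\<lambda>(z, t). lik \<theta> z t) \<in> borel_measurable (MZ \<Otimes>\<^sub>M MT)"
    and sets_ref: "y \<in> space MY \<Longrightarrow> sets (ref y) = sets MT"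
    and lik_decoder: "\<theta> \<in> \<Theta> \<Longrightarrow> z \<in> space MZ \<Longrightarrow> y \<in> space MY \<Longrightarrow>
      distr (density MX (dec \<theta> z)) MT (\<lambda>x. xt (x, y)) = density (ref y) (lik \<theta> z)"

text \<open>In the following definitions \<open>q\<close> and \<open>c\<close> are the conditional densities at fixed parameters.\<close>

definition r_joint :: "'z measure \<Rightarrow> ('x \<times> 'y) measure \<Rightarrow> ('x \<Rightarrow> 'z \<Rightarrow> ennreal) \<Rightarrow>
    (('x \<times> 'y) \<times> 'z) measure" where
  "r_joint MZ pdata q = density (pdata \<Otimes>\<^sub>M MZ) (\<lambda>((x, y), z). q x z)"

definition pdata_y :: "'y measure \<Rightarrow> ('x \<times> 'y) measure \<Rightarrow> 'y measure" where
  "pdata_y MY pdata = distr pdata MY snd"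

definition r_yz :: "'y measure \<Rightarrow> 'z measure \<Rightarrow> ('x \<times> 'y) measure \<Rightarrow> ('x \<Rightarrow> 'z \<Rightarrow> ennreal) \<Rightarrow>
    ('y \<times> 'z) measure" where
  "r_yz MY MZ pdata q = distr (r_joint MZ pdata q) (MY \<Otimes>\<^sub>M MZ) (\<lambda>((x, y), z). (y, z))"

text \<open>
  \<open>r(z | y)\<close> as a density in \<open>z\<close> with respect to \<open>MZ\<close>: the joint law of \<open>(y, z)\<close>
  relative to \<open>p\<^sub>d\<^sub>a\<^sub>t\<^sub>a(dy) MZ(dz)\<close>.  The lemmas below show that this derivative exists and that
  it is \<open>r(z, y) / r(y)\<close>, with \<open>x\<close> integrated out, when the data distribution has a density.
\<close>

definition r_cond :: "'y measure \<Rightarrow> 'z measure \<Rightarrow> ('x \<times> 'y) measure \<Rightarrow> ('x \<Rightarrow> 'z \<Rightarrow> ennreal) \<Rightarrow>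
    'y \<Rightarrow> 'z \<Rightarrow> ennreal" where
  "r_cond MY MZ pdata q y z =
     RN_deriv (pdata_y MY pdata \<Otimes>\<^sub>M MZ) (r_yz MY MZ pdata q) (y, z)"

text \<open>
  With \<open>c\<close> replaced by \<open>r(z | y)\<close> the integrand below no longer depends on \<open>\<psi>\<close>, and it is the sum of
  the integrands of the objective and of the expected divergence.  The theorem assumes it to be
  absolutely integrable under \<open>r\<close>: otherwise the objective can be infinite, or undefined, for all
  \<open>\<psi>\<close> while the divergences differ.  No integrability of the \<open>c\<close> themselves is assumed.
\<close>

definition O_for :: "'z measure \<Rightarrow> ('x \<times> 'y) measure \<Rightarrow> ('x \<times> 'y \<Rightarrow> 't) \<Rightarrow>
    ('z \<Rightarrow> 't \<Rightarrow> ennreal) \<Rightarrow> ('x \<Rightarrow> 'z \<Rightarrow> ennreal) \<Rightarrow> ('y \<Rightarrow> 'z \<Rightarrow> ennreal) \<Rightarrow> ereal" where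
  "O_for MZ pdata xt lik q c =
     expect pdata (\<lambda>(x, y). expect (density MZ (q x))
       (\<lambda>z. eln (lik z (xt (x, y)) * c y z / q x z)))"

lemma (in cond_vae) density_r_cond:
  assumes "\<phi> \<in> \<Phi>"
  shows "density (pdata_y MY pdata \<Otimes>\<^sub>M MZ) (\<lambda>(y, z). r_cond MY MZ pdata (q \<phi>) y z)
    = r_yz MY MZ pdata (q \<phi>)"
proof -
  interpret Z: sigma_finite_measure MZ by (rule sigma_finite_MZ)
  interpret P: prob_space pdata by (rule prob_pdata)
  have [measurable_cong]: "sets pdata = sets (MX \<Otimes>\<^sub>M MY)" by (rule sets_pdata)
  have [measurable]: "(\<lambda>(x, z). q \<phi> x z) \<in> borel_measurable (MX \<Otimes>\<^sub>M MZ)"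
    using encoder[OF assms] by (simp add: cond_density_def)
  have "(\<lambda>v. q \<phi> (fst (fst v)) (snd v)) \<in> borel_measurable (pdata \<Otimes>\<^sub>M MZ)"
    by measurable
  then have qm: "(\<lambda>((x, y), z). q \<phi> x z) \<in> borel_measurable (pdata \<Otimes>\<^sub>M MZ)"
    by (simp add: case_prod_unfold)
  have sndm [measurable]: "snd \<in> pdata \<rightarrow>\<^sub>M MY" by measurable
  interpret Y: prob_space "pdata_y MY pdata"
    unfolding pdata_y_def by (rule P.prob_space_distr) measurable
  have [measurable_cong]: "sets (pdata_y MY pdata) = sets MY" by (simp add: pdata_y_def)
  interpret YZ: pair_sigma_finite "pdata_y MY pdata" MZ ..
  interpret PZ: pair_sigma_finite pdata MZ ..
  let ?M = "pdata_y MY pdata \<Otimes>\<^sub>M MZ" and ?N = "r_yz MY MZ pdata (q \<phi>)"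
  have sets: "sets ?N = sets ?M" by (simp add: r_yz_def pdata_y_def cong: sets_pair_measure_cong)
  have "absolutely_continuous ?M ?N"
    unfolding absolutely_continuous_def
  proof
    fix S assume S: "S \<in> null_sets ?M"
    then have Sm: "S \<in> sets (MY \<Otimes>\<^sub>M MZ)"
      by (auto simp: null_sets_def pdata_y_def cong: sets_pair_measure_cong)
    have "AE w in ?M. w \<notin> S" using S by (rule AE_not_in)
    then have "AE y in pdata_y MY pdata. AE z in MZ. (y, z) \<notin> S"
      by (rule YZ.AE_pair)
    then have *: "AE w in pdata. AE z in MZ. (snd w, z) \<notin> S"
      unfolding pdata_y_def by (rule AE_distrD[OF sndm])
    have Tm: "(\<lambda>v. (snd (fst v), snd v)) \<in> r_joint MZ pdata (q \<phi>) \<rightarrow>\<^sub>M MY \<Otimes>\<^sub>M MZ"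
      unfolding r_joint_def by measurable
    note Sm [measurable]
    have "AE w in pdata \<Otimes>\<^sub>M MZ. (snd (fst w), snd w) \<notin> S"
    proof (rule PZ.AE_pair_measure)
      show "{w \<in> space (pdata \<Otimes>\<^sub>M MZ). (snd (fst w), snd w) \<notin> S} \<in> sets (pdata \<Otimes>\<^sub>M MZ)"
        by measurable
      show "AE w in pdata. AE z in MZ. (snd (fst (w, z)), snd (w, z)) \<notin> S"
        using * by simp
    qed
    then have "AE w in r_joint MZ pdata (q \<phi>). (snd (fst w), snd w) \<notin> S"
      unfolding r_joint_def by (subst AE_density[OF qm]) auto
    then have "AE w in ?N. w \<notin> S"
      unfolding r_yz_def case_prod_unfold
      by (subst AE_distr_iff[OF Tm]) auto
    then show "S \<in> null_sets ?N"
      using Sm by (subst (asm) AE_iff_null_sets[symmetric]) (auto simp: r_yz_def)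
  qed
  then have "density ?M (RN_deriv ?M ?N) = ?N"
    using sets by (rule YZ.density_RN_deriv)
  then show ?thesis by (simp add: r_cond_def split_beta)
qed

lemma (in cond_vae) r_cond_eq_quotient:
  assumes "\<phi> \<in> \<Phi>" and "sigma_finite_measure MX" and "sigma_finite_measure MY"
    and p: "p \<in> borel_measurable (MX \<Otimes>\<^sub>M MY)" and pd: "pdata = density (MX \<Otimes>\<^sub>M MY) p"
  shows "AE (y, z) in pdata_y MY pdata \<Otimes>\<^sub>M MZ. r_cond MY MZ pdata (q \<phi>) y z =
    (\<integral>\<^sup>+ x. p (x, y) * q \<phi> x z \<partial>MX) / (\<integral>\<^sup>+ x. p (x, y) \<partial>MX)"
proof -
  interpret X: sigma_finite_measure MX by fact
  interpret Y0: sigma_finite_measure MY by fact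
  interpret Z: sigma_finite_measure MZ by (rule sigma_finite_MZ)
  interpret P: prob_space pdata by (rule prob_pdata)
  interpret XY: pair_sigma_finite MX MY ..
  interpret XZ: pair_sigma_finite MX MZ ..
  have [measurable_cong]: "sets pdata = sets (MX \<Otimes>\<^sub>M MY)" by (rule sets_pdata)
  note p [measurable]
  have qm [measurable]: "(\<lambda>(x, z). q \<phi> x z) \<in> borel_measurable (MX \<Otimes>\<^sub>M MZ)"
    using encoder[OF assms(1)] by (simp add: cond_density_def)
  have sndm [measurable]: "snd \<in> pdata \<rightarrow>\<^sub>M MY" by measurable
  interpret Y: prob_space "pdata_y MY pdata"
    unfolding pdata_y_def by (rule P.prob_space_distr) measurable
  have [measurable_cong]: "sets (pdata_y MY pdata) = sets MY" by (simp add: pdata_y_def)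
  interpret YZ: pair_sigma_finite "pdata_y MY pdata" MZ ..
  let ?M = "pdata_y MY pdata \<Otimes>\<^sub>M MZ" and ?N = "r_yz MY MZ pdata (q \<phi>)"
  define n where "n y z = (\<integral>\<^sup>+ x. p (x, y) * q \<phi> x z \<partial>MX)" for y z
  define m where "m y = (\<integral>\<^sup>+ x. p (x, y) \<partial>MX)" for y
  have nm [measurable]: "(\<lambda>w. n (fst w) (snd w)) \<in> borel_measurable (MY \<Otimes>\<^sub>M MZ)"
    unfolding n_def by measurable
  have mm [measurable]: "m \<in> borel_measurable MY"
    unfolding m_def by measurable
  have int_pd: "(\<integral>\<^sup>+ w. f w \<partial>pdata) = (\<integral>\<^sup>+ y. \<integral>\<^sup>+ x. p (x, y) * f (x, y) \<partial>MX \<partial>MY)"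
    if [measurable]: "f \<in> borel_measurable (MX \<Otimes>\<^sub>M MY)" for f
    unfolding pd by (simp add: nn_integral_density XY.nn_integral_snd[symmetric])
  have "(\<integral>\<^sup>+ y. m y \<partial>MY) = 1"
    using int_pd[of "\<lambda>_. 1"] P.emeasure_space_1 by (simp add: m_def)
  then have "AE y in MY. m y \<noteq> \<infinity>"
    by (intro nn_integral_noteq_infinite) auto
  then have cancel: "AE y in MY. \<forall>z \<in> space MZ. m y * (n y z / m y) = n y z"
    using AE_space
  proof eventually_elim
    case (elim y)
    show ?case
    proof
      fix z assume [measurable]: "z \<in> space MZ"
      have [measurable]: "y \<in> space MY" by fact
      show "m y * (n y z / m y) = n y z"
      proof (cases "m y = 0")
        case True
        then have "AE x in MX. p (x, y) = 0"
          unfolding m_def by (subst (asm) nn_integral_0_iff_AE) auto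
        then have "n y z = (\<integral>\<^sup>+ x. 0 \<partial>MX)"
          unfolding n_def by (intro nn_integral_cong_AE) auto
        then show ?thesis by simp
      next
        case False
        then show ?thesis using elim
          by (metis ennreal_mult_divide_eq ennreal_times_divide infinity_ennreal_def mult.commute)
      qed
    qed
  qed
  have "density ?M (\<lambda>w. n (fst w) (snd w) / m (fst w)) = ?N"
  proof (rule measure_eqI)
    show "sets (density ?M (\<lambda>w. n (fst w) (snd w) / m (fst w))) = sets ?N"
      by (simp add: r_yz_def pdata_y_def cong: sets_pair_measure_cong)
    fix S assume "S \<in> sets (density ?M (\<lambda>w. n (fst w) (snd w) / m (fst w)))"
    then have S [measurable]: "S \<in> sets (MY \<Otimes>\<^sub>M MZ)"
      by (simp add: pdata_y_def cong: sets_pair_measure_cong)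
    define g where "g y = (\<integral>\<^sup>+ z. n y z / m y * indicator S (y, z) \<partial>MZ)" for y
    have [measurable]: "g \<in> borel_measurable MY" unfolding g_def by measurable
    have "emeasure (density ?M (\<lambda>w. n (fst w) (snd w) / m (fst w))) S
        = (\<integral>\<^sup>+ w. n (fst w) (snd w) / m (fst w) * indicator S w \<partial>?M)"
      by (rule emeasure_density) measurable
    also have "\<dots> = (\<integral>\<^sup>+ y. g y \<partial>pdata_y MY pdata)"
      unfolding g_def by (subst Z.nn_integral_fst[symmetric]) auto
    also have "\<dots> = (\<integral>\<^sup>+ w. g (snd w) \<partial>pdata)"
      unfolding pdata_y_def by (rule nn_integral_distr) measurable
    also have "\<dots> = (\<integral>\<^sup>+ y. m y * g y \<partial>MY)"
      by (simp add: int_pd m_def nn_integral_multc cong: nn_integral_cong)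
    also have "\<dots> = (\<integral>\<^sup>+ y. \<integral>\<^sup>+ z. n y z * indicator S (y, z) \<partial>MZ \<partial>MY)"
      unfolding g_def
    proof (rule nn_integral_cong_AE)
      show "AE y in MY. m y * (\<integral>\<^sup>+ z. n y z / m y * indicator S (y, z) \<partial>MZ)
          = (\<integral>\<^sup>+ z. n y z * indicator S (y, z) \<partial>MZ)"
        using cancel AE_space
      proof eventually_elim
        case (elim y)
        have [measurable]: "y \<in> space MY" by fact
        have [measurable]: "n y \<in> borel_measurable MZ"
          unfolding n_def by measurable
        have "m y * (\<integral>\<^sup>+ z. n y z / m y * indicator S (y, z) \<partial>MZ)
            = (\<integral>\<^sup>+ z. m y * (n y z / m y * indicator S (y, z)) \<partial>MZ)"
          by (rule nn_integral_cmult[symmetric]) measurable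
        also have "\<dots> = (\<integral>\<^sup>+ z. n y z * indicator S (y, z) \<partial>MZ)"
          using elim by (intro nn_integral_cong) (simp add: mult.assoc[symmetric])
        finally show ?case .
      qed
    qed
    also have "\<dots> = (\<integral>\<^sup>+ y. \<integral>\<^sup>+ z. \<integral>\<^sup>+ x. p (x, y) * q \<phi> x z * indicator S (y, z) \<partial>MX \<partial>MZ \<partial>MY)"
      unfolding n_def by (intro nn_integral_cong nn_integral_multc[symmetric]) measurable
    also have "\<dots> = (\<integral>\<^sup>+ y. \<integral>\<^sup>+ x. \<integral>\<^sup>+ z. p (x, y) * q \<phi> x z * indicator S (y, z) \<partial>MZ \<partial>MX \<partial>MY)"
      by (intro nn_integral_cong XZ.Fubini') measurable
    also have "\<dots> = (\<integral>\<^sup>+ y. \<integral>\<^sup>+ x. p (x, y) * (\<integral>\<^sup>+ z. q \<phi> x z * indicator S (y, z) \<partial>MZ) \<partial>MX \<partial>MY)"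
      by (intro nn_integral_cong) (simp add: nn_integral_cmult[symmetric] mult.assoc)
    also have "\<dots> = (\<integral>\<^sup>+ w. \<integral>\<^sup>+ z. q \<phi> (fst w) z * indicator S (snd w, z) \<partial>MZ \<partial>pdata)"
      by (simp add: int_pd)
    also have "\<dots> = (\<integral>\<^sup>+ v. q \<phi> (fst (fst v)) (snd v) * indicator S (snd (fst v), snd v) \<partial>(pdata \<Otimes>\<^sub>M MZ))"
      by (subst Z.nn_integral_fst[symmetric]) auto
    also have "\<dots> = (\<integral>\<^sup>+ v. indicator S (snd (fst v), snd v) \<partial>r_joint MZ pdata (q \<phi>))"
      unfolding r_joint_def case_prod_unfold by (subst nn_integral_density) auto
    also have "\<dots> = (\<integral>\<^sup>+ u. indicator S u \<partial>?N)"
      unfolding r_yz_def r_joint_def case_prod_unfold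
      by (subst nn_integral_distr) auto
    also have "\<dots> = emeasure ?N S"
      using S by (simp add: r_yz_def)
    finally show "emeasure (density ?M (\<lambda>w. n (fst w) (snd w) / m (fst w))) S = emeasure ?N S" .
  qed
  then have "AE w in ?M. n (fst w) (snd w) / m (fst w) = RN_deriv ?M ?N w"
    by (intro YZ.RN_deriv_unique) measurable
  then show ?thesis
    by (auto simp: r_cond_def n_def m_def split_beta)
qed

end

theory Submission
  imports Defs
begin

text \<open>
  Under \<open>r\<close> one has \<open>log (p c / q) = log (p r(z|y) / q) - log (r(z|y) / c)\<close> almost everywhere, so the
  objective is a finite constant minus the expected divergence.  Splitting the expectations is
  legitimate although the divergence may be infinite: by \<open>ln t \<le> t\<close>, the negative part of
  \<open>log (r(z|y) / c)\<close> has integral at most \<open>1\<close>.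
\<close>

section \<open>Pointwise facts about the extended logarithm\<close>

lemma measurable_eln [measurable]: "eln \<in> borel_measurable borel"
  unfolding eln_def[abs_def] by measurable

text \<open>The finiteness assumption \<open>fin\<close> confines \<open>l\<close> to the positive
  reals, so among the factors only \<open>c\<close> can still be degenerate. If \<open>c\<close> is
  \<open>0\<close>, then \<open>r / c\<close> is infinite and both sides equal minus infinity;
  otherwise this is the functional equation of the real logarithm.\<close>

lemma eln_mult_divide_split:
  assumes q: "q \<noteq> 0" "q \<noteq> \<infinity>" and r: "r \<noteq> 0" "r \<noteq> \<infinity>" and c: "c \<noteq> \<infinity>"
    and fin: "\<bar>eln (l * r / q)\<bar> \<noteq> \<infinity>"
  shows "eln (l * c / q) = eln (l * r / q) - eln (r / c)"
proof -
  obtain q' where q': "q = ennreal q'" "q' > 0"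
    using q by (cases q) (auto simp: less_le)
  obtain r' where r': "r = ennreal r'" "r' > 0"
    using r by (cases r) (auto simp: less_le)
  \<comment> \<open>With \<open>q\<close> and \<open>r\<close> positive and finite,
    \<open>l = 0\<close> or \<open>l = \<infinity>\<close> would make the quotient \<open>0\<close>
    or infinite, where \<open>eln\<close> is infinite.\<close>
  have "l \<noteq> 0" "l \<noteq> \<infinity>"
    using fin q' r' by (auto simp: eln_def ennreal_top_mult ennreal_top_divide)
  then obtain l' where l': "l = ennreal l'" "l' > 0"
    by (cases l) (auto simp: less_le)
  obtain c' where c': "c = ennreal c'" "c' \<ge> 0"
    using c by (cases c) auto
  show ?thesis
  proof (cases "c' = 0")
    case True
    then show ?thesis using q' r' l' c'
      by (simp add: eln_def divide_ennreal ennreal_mult[symmetric] ennreal_divide_zero)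
  next
    case False
    then show ?thesis using q' r' l' c'
      by (simp add: eln_def divide_ennreal ennreal_mult[symmetric] ln_mult ln_div)
  qed
qed

text \<open>This is \<open>ln t \<le> t\<close> at \<open>t = p' / p\<close>, multiplied by
  \<open>p\<close>. Integrated, it bounds the negative part of a divergence by the total mass of its
  second argument. The case \<open>p = 0\<close> rests on the convention that \<open>0\<close> times
  infinity is \<open>0\<close>.\<close>

lemma mult_neg_part_eln_le: "p * e2ennreal (- eln (p / p')) \<le> p'"
proof (cases "p = 0 \<or> p' = \<infinity>")
  case True
  then show ?thesis by auto
next
  case False
  then have p: "p \<noteq> 0" "p' \<noteq> \<infinity>" by auto
  show ?thesis
  proof (cases "p = \<infinity> \<or> p' = 0")
    case True
    \<comment> \<open>An infinite quotient has an infinite logarithm, whose negative part is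
      \<open>0\<close>.\<close>
    then have "p / p' = \<infinity>"
      using p by (auto simp: ennreal_top_divide ennreal_divide_zero less_top)
    then show ?thesis by (simp add: eln_def e2ennreal_neg)
  next
    case False
    then obtain a b where ab: "p = ennreal a" "a > 0" "p' = ennreal b" "b > 0"
      using p by (cases p; cases p') (auto simp: less_le)
    have "p * e2ennreal (- eln (p / p')) = ennreal (a * max 0 (ln (b / a)))"
      using ab by (simp add: eln_def divide_ennreal ln_div ennreal_mult' e2ennreal_ereal max_def ennreal_neg)
    also have "\<dots> \<le> ennreal b"
    proof (rule ennreal_leI)
      have "ln (b / a) \<le> b / a" using ab ln_le_minus_one[of "b / a"] by simp
      then have "a * ln (b / a) \<le> b" using ab by (simp add: field_simps)
      then show "a * max 0 (ln (b / a)) \<le> b" using ab by (simp add: max_def)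
    qed
    finally show ?thesis using ab by simp
  qed
qed

section \<open>Differences of nonnegative extended numbers\<close>

text \<open>The positive and negative parts form the smallest way to write \<open>d\<close> as a
  difference. The last equation is \<open>d = u - v\<close> with all subtractions moved to the other
  side, so that it can be integrated by additivity of the nonnegative integral.\<close>

lemma ennreal_diff_parts:
  fixes u v :: ennreal
  assumes "u \<noteq> \<infinity> \<or> v \<noteq> \<infinity>" and d: "d = enn2ereal u - enn2ereal v"
  shows "e2ennreal d \<le> u \<and> e2ennreal (- d) \<le> v \<and> e2ennreal d + v = u + e2ennreal (- d)"
proof -
  consider "u = \<infinity>" "v \<noteq> \<infinity>" | "v = \<infinity>" "u \<noteq> \<infinity>"
    | a b where "u = ennreal a" "0 \<le> a" "v = ennreal b" "0 \<le> b"
    using assms(1) by (cases u; cases v) auto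
  then show ?thesis
  proof cases
    case 1
    then have "d = \<infinity>" unfolding d by (cases v) (auto simp: enn2ereal_ennreal)
    then show ?thesis using 1 by (simp add: e2ennreal_neg)
  next
    case 2
    then have "d = - \<infinity>" unfolding d by (cases u) (auto simp: enn2ereal_ennreal)
    then show ?thesis using 2 by (simp add: e2ennreal_neg)
  next
    case (3 a b)
    then have d': "d = ereal (a - b)" by (simp add: d enn2ereal_ennreal)
    show ?thesis
    proof (cases "a \<le> b")
      case True
      then show ?thesis using 3 unfolding d'
        by (auto simp: e2ennreal_ereal ennreal_neg ennreal_plus[symmetric]
            intro!: ennreal_leI simp del: ennreal_plus)
    next
      case False
      then show ?thesis using 3 unfolding d'
        by (auto simp: e2ennreal_ereal ennreal_neg ennreal_plus[symmetric]
            intro!: ennreal_leI simp del: ennreal_plus)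
    qed
  qed
qed

text \<open>Recovers differences from an additive identity. An equation between two infinite sums
  carries too little information, so either both minuends or both subtrahends have to be finite for
  the terms to be moved across.\<close>

lemma enn2ereal_diff_eqI:
  fixes a b u v :: ennreal
  assumes sum: "a + v = u + b" and fin: "a \<noteq> \<infinity> \<and> u \<noteq> \<infinity> \<or> b \<noteq> \<infinity> \<and> v \<noteq> \<infinity>"
  shows "enn2ereal a - enn2ereal b = enn2ereal u - enn2ereal v"
proof -
  have "enn2ereal a + enn2ereal v = enn2ereal u + enn2ereal b"
    using arg_cong[OF sum, of enn2ereal] by (simp add: plus_ennreal.rep_eq)
  moreover have "0 \<le> enn2ereal a" "0 \<le> enn2ereal b" "0 \<le> enn2ereal u" "0 \<le> enn2ereal v"
    by simp_all
  moreover have "enn2ereal a \<noteq> \<infinity> \<and> enn2ereal u \<noteq> \<infinity> \<or> enn2ereal b \<noteq> \<infinity> \<and> enn2ereal v \<noteq> \<infinity>"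
    using fin by (auto simp: enn2ereal_eq_top_iff)
  ultimately show ?thesis
    by (cases "enn2ereal a"; cases "enn2ereal b"; cases "enn2ereal u"; cases "enn2ereal v") auto
qed

text \<open>Only \<open>b\<close> may be infinite, and then both sides are minus infinity. The rule
  serves twice: for values at a point and for integrals.\<close>

lemma enn2ereal_diff_add:
  fixes a a' b b' :: ennreal
  assumes "a \<noteq> \<infinity>" "a' \<noteq> \<infinity>" "b' \<noteq> \<infinity>"
  shows "enn2ereal (a + b') - enn2ereal (a' + b) =
    (enn2ereal a - enn2ereal a') - (enn2ereal b - enn2ereal b')"
proof -
  have "0 \<le> enn2ereal a" "0 \<le> enn2ereal a'" "0 \<le> enn2ereal b" "0 \<le> enn2ereal b'"
    by simp_all
  moreover have "enn2ereal a \<noteq> \<infinity>" "enn2ereal a' \<noteq> \<infinity>" "enn2ereal b' \<noteq> \<infinity>"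
    using assms by (auto simp: enn2ereal_eq_top_iff)
  ultimately show ?thesis unfolding plus_ennreal.rep_eq
    by (cases "enn2ereal a"; cases "enn2ereal a'"; cases "enn2ereal b"; cases "enn2ereal b'") auto
qed

lemma ereal_eq_diff_parts:
  "(x :: ereal) = enn2ereal (e2ennreal x) - enn2ereal (e2ennreal (- x))"
proof (cases x)
  case (real r)
  then show ?thesis
    by (cases "0 \<le> r") (auto simp: e2ennreal_ereal enn2ereal_ennreal ennreal_neg zero_ennreal.rep_eq)
qed (auto simp: e2ennreal_neg zero_ennreal.rep_eq)

section \<open>Expectations of functions with values in the extended reals\<close>

text \<open>An expectation can be computed from any decomposition \<open>u - v\<close>, not only
  from the positive and negative parts. Integrating \<open>ennreal_diff_parts\<close> gives an
  additive identity between the four integrals, and minimality of the parts passes the finiteness of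
  one integral on, as cancellation requires.\<close>

lemma expect_eq_diff:
  assumes f [measurable]: "f \<in> borel_measurable M"
    and [measurable]: "u \<in> borel_measurable M" "v \<in> borel_measurable M"
    and fin: "(\<integral>\<^sup>+ x. u x \<partial>M) \<noteq> \<infinity> \<or> (\<integral>\<^sup>+ x. v x \<partial>M) \<noteq> \<infinity>"
    and eq: "AE x in M. f x = enn2ereal (u x) - enn2ereal (v x)"
  shows "expect M f = enn2ereal (\<integral>\<^sup>+ x. u x \<partial>M) - enn2ereal (\<integral>\<^sup>+ x. v x \<partial>M)"
proof -
  \<comment> \<open>A finite integral rules out the undefined form infinity minus infinity almost
    everywhere.\<close>
  have "AE x in M. u x \<noteq> \<infinity> \<or> v x \<noteq> \<infinity>"
    using fin
  proof
    assume "(\<integral>\<^sup>+ x. u x \<partial>M) \<noteq> \<infinity>"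
    then have "AE x in M. u x \<noteq> \<infinity>" by (intro nn_integral_noteq_infinite) auto
    then show ?thesis by eventually_elim simp
  next
    assume "(\<integral>\<^sup>+ x. v x \<partial>M) \<noteq> \<infinity>"
    then have "AE x in M. v x \<noteq> \<infinity>" by (intro nn_integral_noteq_infinite) auto
    then show ?thesis by eventually_elim simp
  qed
  with eq have parts: "AE x in M. e2ennreal (f x) \<le> u x \<and> e2ennreal (- f x) \<le> v x \<and>
      e2ennreal (f x) + v x = u x + e2ennreal (- f x)"
    by eventually_elim (rule ennreal_diff_parts)
  let ?a = "\<integral>\<^sup>+ x. e2ennreal (f x) \<partial>M" and ?b = "\<integral>\<^sup>+ x. e2ennreal (- f x) \<partial>M"
  have "?a + (\<integral>\<^sup>+ x. v x \<partial>M) = (\<integral>\<^sup>+ x. e2ennreal (f x) + v x \<partial>M)"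
    by (rule nn_integral_add[symmetric]) measurable
  also have "\<dots> = (\<integral>\<^sup>+ x. u x + e2ennreal (- f x) \<partial>M)"
    using parts by (intro nn_integral_cong_AE) auto
  also have "\<dots> = (\<integral>\<^sup>+ x. u x \<partial>M) + ?b"
    by (rule nn_integral_add) measurable
  finally have sum: "?a + (\<integral>\<^sup>+ x. v x \<partial>M) = (\<integral>\<^sup>+ x. u x \<partial>M) + ?b" .
  have "?a \<le> (\<integral>\<^sup>+ x. u x \<partial>M)" "?b \<le> (\<integral>\<^sup>+ x. v x \<partial>M)"
    using parts by (auto intro!: nn_integral_mono_AE)
  then show ?thesis
    unfolding expect_def using sum fin
    by (intro enn2ereal_diff_eqI) (auto simp: top_unique)
qed

lemma expect_distr:
  assumes [measurable]: "T \<in> M \<rightarrow>\<^sub>M N" "f \<in> borel_measurable N"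
  shows "expect (distr M N T) f = expect M (\<lambda>x. f (T x))"
  unfolding expect_def by (simp add: nn_integral_distr)

text \<open>Fubini's theorem under one-sided finiteness, so that the common value may be infinite.
  Tonelli's theorem is applied to the two parts separately, and \<open>expect_eq_diff\<close>
  recombines them, the inner expectations being \<open>u - v\<close>.\<close>

lemma (in sigma_finite_measure) expect_iterated:
  assumes k [measurable]: "k \<in> borel_measurable (N \<Otimes>\<^sub>M M)"
    and f [measurable]: "f \<in> borel_measurable (N \<Otimes>\<^sub>M M)"
    and fin: "(\<integral>\<^sup>+ w. e2ennreal (f w) \<partial>density (N \<Otimes>\<^sub>M M) k) \<noteq> \<infinity> \<or>
      (\<integral>\<^sup>+ w. e2ennreal (- f w) \<partial>density (N \<Otimes>\<^sub>M M) k) \<noteq> \<infinity>"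
  shows "expect N (\<lambda>x. expect (density M (\<lambda>y. k (x, y))) (\<lambda>y. f (x, y)))
    = expect (density (N \<Otimes>\<^sub>M M) k) f"
proof -
  define u where "u x = (\<integral>\<^sup>+ y. k (x, y) * e2ennreal (f (x, y)) \<partial>M)" for x
  define v where "v x = (\<integral>\<^sup>+ y. k (x, y) * e2ennreal (- f (x, y)) \<partial>M)" for x
  have [measurable]: "u \<in> borel_measurable N" "v \<in> borel_measurable N"
    unfolding u_def v_def by measurable
  have inner: "expect (density M (\<lambda>y. k (x, y))) (\<lambda>y. f (x, y)) = enn2ereal (u x) - enn2ereal (v x)"
    if [measurable]: "x \<in> space N" for x
    unfolding expect_def u_def v_def by (simp add: nn_integral_density)
  have iu: "(\<integral>\<^sup>+ w. e2ennreal (f w) \<partial>density (N \<Otimes>\<^sub>M M) k) = (\<integral>\<^sup>+ x. u x \<partial>N)"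
    unfolding u_def by (simp add: nn_integral_density nn_integral_fst[symmetric])
  have iv: "(\<integral>\<^sup>+ w. e2ennreal (- f w) \<partial>density (N \<Otimes>\<^sub>M M) k) = (\<integral>\<^sup>+ x. v x \<partial>N)"
    unfolding v_def by (simp add: nn_integral_density nn_integral_fst[symmetric])
  \<comment> \<open>The inner measure varies with \<open>x\<close>, so measurability is read off
    from the explicit form \<open>u - v\<close>.\<close>
  have "(\<lambda>x. expect (density M (\<lambda>y. k (x, y))) (\<lambda>y. f (x, y))) \<in> borel_measurable N"
    by (subst measurable_cong[OF inner]) measurable
  then have "expect N (\<lambda>x. expect (density M (\<lambda>y. k (x, y))) (\<lambda>y. f (x, y)))
    = enn2ereal (\<integral>\<^sup>+ x. u x \<partial>N) - enn2ereal (\<integral>\<^sup>+ x. v x \<partial>N)"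
    using fin inner by (intro expect_eq_diff) (auto simp: iu iv)
  then show ?thesis
    by (simp add: expect_def[of "density (N \<Otimes>\<^sub>M M) k"] iu iv)
qed

lemma abs_integrable_parts:
  assumes "abs_integrable M f"
  shows "(\<integral>\<^sup>+ x. e2ennreal (f x) \<partial>M) \<noteq> \<infinity>" "(\<integral>\<^sup>+ x. e2ennreal (- f x) \<partial>M) \<noteq> \<infinity>"
    and "AE x in M. \<bar>f x\<bar> \<noteq> \<infinity>"
proof -
  have [measurable]: "f \<in> borel_measurable M" and fin: "(\<integral>\<^sup>+ x. e2ennreal \<bar>f x\<bar> \<partial>M) < \<infinity>"
    using assms by (auto simp: abs_integrable_def)
  have "(\<integral>\<^sup>+ x. e2ennreal (f x) \<partial>M) \<le> (\<integral>\<^sup>+ x. e2ennreal \<bar>f x\<bar> \<partial>M)"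
    by (intro nn_integral_mono e2ennreal_mono)
      (metis abs_ereal.simps ereal_cases ereal_less_eq(1,2,3) abs_ge_self
        abs_ge_minus_self uminus_ereal.simps)
  then show "(\<integral>\<^sup>+ x. e2ennreal (f x) \<partial>M) \<noteq> \<infinity>" using fin by (auto simp: top_unique)
  have "(\<integral>\<^sup>+ x. e2ennreal (- f x) \<partial>M) \<le> (\<integral>\<^sup>+ x. e2ennreal \<bar>f x\<bar> \<partial>M)"
    by (intro nn_integral_mono e2ennreal_mono)
      (metis abs_ereal.simps ereal_cases ereal_less_eq(1,2,3) abs_ge_self
        abs_ge_minus_self uminus_ereal.simps)
  then show "(\<integral>\<^sup>+ x. e2ennreal (- f x) \<partial>M) \<noteq> \<infinity>" using fin by (auto simp: top_unique)
  have "AE x in M. e2ennreal \<bar>f x\<bar> \<noteq> \<infinity>"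
    using fin by (intro nn_integral_noteq_infinite) auto
  then show "AE x in M. \<bar>f x\<bar> \<noteq> \<infinity>"
    by eventually_elim auto
qed

text \<open>\<open>B\<close> may have expectation plus infinity; only its negative part is
  controlled. Writing \<open>f\<close> as
  \<open>(A\<^sup>+ + B\<^sup>-) - (A\<^sup>- + B\<^sup>+)\<close> puts every term needed for a
  finite minuend into \<open>u\<close>, so \<open>expect_eq_diff\<close> applies. The first
  conclusion is what permits iterating the integral of \<open>f\<close>.\<close>

lemma expect_diff:
  assumes A: "abs_integrable M A"
    and [measurable]: "B \<in> borel_measurable M" "f \<in> borel_measurable M"
    and B: "(\<integral>\<^sup>+ x. e2ennreal (- B x) \<partial>M) \<noteq> \<infinity>"
    and eq: "AE x in M. f x = A x - B x"
  shows "(\<integral>\<^sup>+ x. e2ennreal (f x) \<partial>M) \<noteq> \<infinity>"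
    and "expect M f = expect M A - expect M B"
proof -
  have [measurable]: "A \<in> borel_measurable M" using A by (simp add: abs_integrable_def)
  define u where "u x = e2ennreal (A x) + e2ennreal (- B x)" for x
  define v where "v x = e2ennreal (- A x) + e2ennreal (B x)" for x
  have [measurable]: "u \<in> borel_measurable M" "v \<in> borel_measurable M"
    unfolding u_def v_def by measurable
  have iu: "(\<integral>\<^sup>+ x. u x \<partial>M) = (\<integral>\<^sup>+ x. e2ennreal (A x) \<partial>M) + (\<integral>\<^sup>+ x. e2ennreal (- B x) \<partial>M)"
    unfolding u_def by (rule nn_integral_add) measurable
  have iv: "(\<integral>\<^sup>+ x. v x \<partial>M) = (\<integral>\<^sup>+ x. e2ennreal (- A x) \<partial>M) + (\<integral>\<^sup>+ x. e2ennreal (B x) \<partial>M)"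
    unfolding v_def by (rule nn_integral_add) measurable
  note fins = abs_integrable_parts[OF A]
  have fu: "(\<integral>\<^sup>+ x. u x \<partial>M) \<noteq> \<infinity>" using fins B by (auto simp: iu)
  have parts: "A x - B x = enn2ereal (u x) - enn2ereal (v x)"
    if A: "\<bar>A x\<bar> \<noteq> \<infinity>" and B: "e2ennreal (- B x) \<noteq> \<infinity>" for x
  proof -
    have "e2ennreal (A x) \<noteq> \<infinity>" "e2ennreal (- A x) \<noteq> \<infinity>"
      using A by (cases "A x"; simp add: e2ennreal_ereal)+
    then show ?thesis unfolding u_def v_def
      using B by (simp add: enn2ereal_diff_add ereal_eq_diff_parts[symmetric])
  qed
  have "AE x in M. e2ennreal (- B x) \<noteq> \<infinity>"
    using B by (intro nn_integral_noteq_infinite) auto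
  with eq fins(3) have eq': "AE x in M. f x = enn2ereal (u x) - enn2ereal (v x)"
    by eventually_elim (use parts in simp)
  have "AE x in M. e2ennreal (f x) \<le> u x"
  proof -
    have "AE x in M. u x \<noteq> \<infinity>" using fu by (intro nn_integral_noteq_infinite) auto
    with eq' show ?thesis by eventually_elim (use ennreal_diff_parts in blast)
  qed
  then have "(\<integral>\<^sup>+ x. e2ennreal (f x) \<partial>M) \<le> (\<integral>\<^sup>+ x. u x \<partial>M)"
    by (rule nn_integral_mono_AE)
  with fu show "(\<integral>\<^sup>+ x. e2ennreal (f x) \<partial>M) \<noteq> \<infinity>" by (auto simp: top_unique)
  have "expect M f = enn2ereal (\<integral>\<^sup>+ x. u x \<partial>M) - enn2ereal (\<integral>\<^sup>+ x. v x \<partial>M)"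
    using fu eq' by (intro expect_eq_diff) auto
  also have "\<dots> = expect M A - expect M B"
    unfolding iu iv expect_def using fins(1,2) B by (rule enn2ereal_diff_add)
  finally show "expect M f = expect M A - expect M B" .
qed

section \<open>Decomposition of the objective\<close>

lemma (in cond_vae) O_for_eq_diff:
  assumes c: "cond_density MY MZ c" and \<theta>: "\<theta> \<in> \<Theta>" and \<phi>: "\<phi> \<in> \<Phi>"
    and int: "abs_integrable (r_joint MZ pdata (q \<phi>))
      (\<lambda>((x, y), z). eln (lik \<theta> z (xt (x, y)) * r_cond MY MZ pdata (q \<phi>) y z / q \<phi> x z))"
  shows "O_for MZ pdata xt (lik \<theta>) (q \<phi>) c =
    expect (r_joint MZ pdata (q \<phi>))
      (\<lambda>((x, y), z). eln (lik \<theta> z (xt (x, y)) * r_cond MY MZ pdata (q \<phi>) y z / q \<phi> x z)) -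
    expect (pdata_y MY pdata) (\<lambda>y. KL MZ (r_cond MY MZ pdata (q \<phi>) y) (c y))"
proof -
  interpret Z: sigma_finite_measure MZ by (rule sigma_finite_MZ)
  interpret P: prob_space pdata by (rule prob_pdata)
  interpret PZ: pair_sigma_finite pdata MZ ..
  have [measurable_cong]: "sets pdata = sets (MX \<Otimes>\<^sub>M MY)" by (rule sets_pdata)
  have space_pdata: "space pdata = space MX \<times> space MY"
    using sets_eq_imp_space_eq[OF sets_pdata] by (simp add: space_pair_measure)
  have sndm [measurable]: "snd \<in> pdata \<rightarrow>\<^sub>M MY" by measurable
  interpret Y: prob_space "pdata_y MY pdata"
    unfolding pdata_y_def by (rule P.prob_space_distr) measurable
  have sY [measurable_cong]: "sets (pdata_y MY pdata) = sets MY" by (simp add: pdata_y_def)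
  have spY: "space (pdata_y MY pdata) = space MY" by (simp add: pdata_y_def)
  define rc where "rc = (\<lambda>w. r_cond MY MZ pdata (q \<phi>) (fst w) (snd w))"
  define qq where "qq = (\<lambda>w :: ('x \<times> 'y) \<times> 'z. q \<phi> (fst (fst w)) (snd w))"
  define cc where "cc = (\<lambda>w. c (fst w) (snd w))"
  define ll where "ll = (\<lambda>w :: ('x \<times> 'y) \<times> 'z. lik \<theta> (snd w) (xt (fst w)))"
  define T where "T = (\<lambda>w :: ('x \<times> 'y) \<times> 'z. (snd (fst w), snd w))"
  let ?PZ = "pdata \<Otimes>\<^sub>M MZ" and ?R = "r_joint MZ pdata (q \<phi>)"
  let ?YZ = "pdata_y MY pdata \<Otimes>\<^sub>M MZ" and ?N = "r_yz MY MZ pdata (q \<phi>)"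
  have "(\<lambda>(x, z). q \<phi> x z) \<in> borel_measurable (MX \<Otimes>\<^sub>M MZ)"
    and q1: "\<And>x. x \<in> space MX \<Longrightarrow> (\<integral>\<^sup>+ z. q \<phi> x z \<partial>MZ) = 1"
    using encoder[OF \<phi>] by (auto simp: cond_density_def)
  note [measurable] = this(1)
  have qm [measurable]: "qq \<in> borel_measurable ?PZ"
    unfolding qq_def by measurable
  have "(\<lambda>(y, z). c y z) \<in> borel_measurable (MY \<Otimes>\<^sub>M MZ)"
    and c1: "\<And>y. y \<in> space MY \<Longrightarrow> (\<integral>\<^sup>+ z. c y z \<partial>MZ) = 1"
    using c by (auto simp: cond_density_def)
  note [measurable] = this(1)
  have cm [measurable]: "cc \<in> borel_measurable (MY \<Otimes>\<^sub>M MZ)"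
    unfolding cc_def by measurable
  have rcm' [measurable]: "rc \<in> borel_measurable ?YZ"
    unfolding rc_def r_cond_def by simp
  have rcm [measurable]: "rc \<in> borel_measurable (MY \<Otimes>\<^sub>M MZ)"
    using rcm' measurable_cong_sets[OF sets_pair_measure_cong[OF sY refl] refl] by blast
  note [measurable] = xt_measurable lik_measurable[OF \<theta>]
  have lm [measurable]: "ll \<in> borel_measurable ?PZ"
    unfolding ll_def by measurable
  have Tm [measurable]: "T \<in> ?PZ \<rightarrow>\<^sub>M MY \<Otimes>\<^sub>M MZ"
    unfolding T_def by measurable
  have R: "?R = density ?PZ qq"
    unfolding r_joint_def qq_def by (simp add: case_prod_unfold)
  have sR [measurable_cong]: "sets ?R = sets ?PZ" by (simp add: R)
  \<comment> \<open>The law of \<open>(y, z)\<close> gets two descriptions: the image of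
    \<open>r\<close> under \<open>T\<close>, which leads to the objective, and the density
    \<open>rc\<close> in \<open>N'\<close>, which leads to the divergence.\<close>
  have N: "?N = distr ?R (MY \<Otimes>\<^sub>M MZ) T"
    unfolding r_yz_def T_def by (simp add: case_prod_unfold)
  have N': "?N = density ?YZ rc"
    using density_r_cond[OF \<phi>] by (simp add: rc_def case_prod_unfold)
  define A where "A = (\<lambda>w. eln (ll w * rc (T w) / qq w))"
  define B where "B = (\<lambda>v. eln (rc v / cc v))"
  define F where "F = (\<lambda>w. eln (ll w * cc (T w) / qq w))"
  have Fm [measurable]: "F \<in> borel_measurable ?PZ" unfolding F_def by measurable
  have Bm [measurable]: "B \<in> borel_measurable (MY \<Otimes>\<^sub>M MZ)" unfolding B_def by measurable
  have A_eq: "(\<lambda>((x, y), z). eln (lik \<theta> z (xt (x, y)) * r_cond MY MZ pdata (q \<phi>) y z / q \<phi> x z)) = A"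
    by (auto simp: A_def ll_def rc_def T_def qq_def)
  have A: "abs_integrable ?R A" using int unfolding A_eq .

  have q_total: "(\<integral>\<^sup>+ w. qq w \<partial>?PZ) = 1"
  proof -
    have "(\<integral>\<^sup>+ w. qq w \<partial>?PZ) = (\<integral>\<^sup>+ w. \<integral>\<^sup>+ z. qq (w, z) \<partial>MZ \<partial>pdata)"
      by (rule Z.nn_integral_fst[symmetric]) measurable
    also have "\<dots> = (\<integral>\<^sup>+ w. 1 \<partial>pdata)"
      by (intro nn_integral_cong) (auto simp: qq_def space_pdata q1)
    finally show ?thesis by (simp add: P.emeasure_space_1)
  qed
  have c_total: "(\<integral>\<^sup>+ v. cc v \<partial>?YZ) = 1"
  proof -
    have "(\<integral>\<^sup>+ v. cc v \<partial>?YZ) = (\<integral>\<^sup>+ y. \<integral>\<^sup>+ z. cc (y, z) \<partial>MZ \<partial>pdata_y MY pdata)"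
      by (rule Z.nn_integral_fst[symmetric]) measurable
    also have "\<dots> = (\<integral>\<^sup>+ y. 1 \<partial>pdata_y MY pdata)"
      by (intro nn_integral_cong) (auto simp: cc_def spY c1)
    finally show ?thesis by (simp add: Y.emeasure_space_1)
  qed
  \<comment> \<open>The mass of \<open>rc\<close> is computed through both descriptions of
    \<open>?N\<close>, reducing it to \<open>q_total\<close>.\<close>
  have rc_total: "(\<integral>\<^sup>+ v. rc v \<partial>?YZ) = 1"
  proof -
    have "(\<integral>\<^sup>+ v. rc v \<partial>?YZ) = (\<integral>\<^sup>+ v. 1 \<partial>?N)"
      unfolding N' by (subst nn_integral_density) auto
    also have "\<dots> = (\<integral>\<^sup>+ w. 1 \<partial>?R)"
      unfolding N by (subst nn_integral_distr) auto
    also have "\<dots> = (\<integral>\<^sup>+ w. qq w \<partial>?PZ)"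
      unfolding R by (subst nn_integral_density) auto
    finally show ?thesis by (simp add: q_total)
  qed
  have neg: "(\<integral>\<^sup>+ v. e2ennreal (- B v) \<partial>?N) \<noteq> \<infinity>"
  proof -
    have "(\<integral>\<^sup>+ v. e2ennreal (- B v) \<partial>?N) = (\<integral>\<^sup>+ v. rc v * e2ennreal (- B v) \<partial>?YZ)"
      unfolding N' by (rule nn_integral_density) measurable
    also have "\<dots> \<le> (\<integral>\<^sup>+ v. cc v \<partial>?YZ)"
      unfolding B_def by (intro nn_integral_mono mult_neg_part_eln_le)
    finally show ?thesis by (auto simp: c_total top_unique)
  qed
  have KL: "expect (pdata_y MY pdata) (\<lambda>y. KL MZ (r_cond MY MZ pdata (q \<phi>) y) (c y)) = expect ?N B"
  proof -
    have "expect (pdata_y MY pdata) (\<lambda>y. expect (density MZ (\<lambda>z. rc (y, z))) (\<lambda>z. B (y, z)))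
      = expect (density ?YZ rc) B"
      \<comment> \<open>Bounding the negative part suffices here, so an infinite expected divergence
        is covered.\<close>
      using neg by (intro Z.expect_iterated) (auto simp: N')
    then show ?thesis by (simp add: N' KL_def rc_def B_def cc_def)
  qed
  have NR: "expect ?N B = expect ?R (\<lambda>w. B (T w))"
    unfolding N by (rule expect_distr) measurable
  have negR: "(\<integral>\<^sup>+ w. e2ennreal (- B (T w)) \<partial>?R) \<noteq> \<infinity>"
    using neg unfolding N by (subst (asm) nn_integral_distr) auto

  have "AE w in ?PZ. qq w \<noteq> \<infinity>"
    using q_total by (intro nn_integral_noteq_infinite) auto
  \<comment> \<open>Nonvanishing is automatic: a measure with density \<open>qq\<close> gives no
    mass to the zeros of \<open>qq\<close>. The same holds for \<open>rc\<close> under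
    \<open>?N\<close>.\<close>
  then have q_fin: "AE w in ?R. qq w \<noteq> 0 \<and> qq w \<noteq> \<infinity>"
    unfolding R by (subst AE_density) (auto)
  have "AE v in ?YZ. rc v \<noteq> \<infinity>"
    using rc_total by (intro nn_integral_noteq_infinite) auto
  moreover have "AE v in ?YZ. cc v \<noteq> \<infinity>"
    using c_total by (intro nn_integral_noteq_infinite) auto
  ultimately have "AE v in ?N. rc v \<noteq> 0 \<and> rc v \<noteq> \<infinity> \<and> cc v \<noteq> \<infinity>"
    unfolding N' by (subst AE_density) auto
  then have rc_fin: "AE w in ?R. rc (T w) \<noteq> 0 \<and> rc (T w) \<noteq> \<infinity> \<and> cc (T w) \<noteq> \<infinity>"
    unfolding N by (rule AE_distrD[rotated]) measurable
  \<comment> \<open>Absolute integrability of \<open>A\<close> supplies the finiteness required by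
    \<open>eln_mult_divide_split\<close>, for almost every point under \<open>r\<close>.\<close>
  have split: "AE w in ?R. F w = A w - B (T w)"
    using q_fin rc_fin abs_integrable_parts(3)[OF A]
    by eventually_elim (auto simp: F_def A_def B_def intro!: eln_mult_divide_split)

  have "(\<lambda>w. B (T w)) \<in> borel_measurable ?R" "F \<in> borel_measurable ?R"
    by measurable
  note diff = expect_diff[OF A this negR split]
  have "O_for MZ pdata xt (lik \<theta>) (q \<phi>) c
      = expect pdata (\<lambda>w. expect (density MZ (\<lambda>z. qq (w, z))) (\<lambda>z. F (w, z)))"
    unfolding O_for_def by (simp add: case_prod_unfold qq_def F_def ll_def cc_def T_def)
  also have "\<dots> = expect ?R F"
    \<comment> \<open>For \<open>F\<close> it is the positive part that is controlled, the opposite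
      side from \<open>B\<close>.\<close>
    unfolding R by (rule Z.expect_iterated[OF qm Fm]) (use diff(1) R in simp)
  finally show ?thesis
    unfolding A_eq KL NR diff(2) .
qed

section \<open>Passage from values to optimisers\<close>

text \<open>Subtraction from a finite constant reverses the order even at infinite values. The
  strict form matches \<open>is_arg_max\<close> and \<open>is_arg_min\<close>, which say that no
  strictly better competitor exists.\<close>

lemma ereal_diff_less_cancel_left:
  fixes a x y :: ereal
  assumes "\<bar>a\<bar> \<noteq> \<infinity>"
  shows "a - x < a - y \<longleftrightarrow> y < x"
  using assms by (cases a; cases x; cases y) auto

theorem theorem3p1:
  fixes MX :: "'x measure" and MY :: "'y measure" and MZ :: "'z measure"
    and MT :: "'t measure" and ref :: "'y \<Rightarrow> 't measure"
    and \<Theta> :: "'th set" and \<Phi> :: "'ph set" and \<Psi> :: "'ps set"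
    and pdata :: "('x \<times> 'y) measure"
    and prior :: "'th \<Rightarrow> 'z \<Rightarrow> ennreal"
    and dec :: "'th \<Rightarrow> 'z \<Rightarrow> 'x \<Rightarrow> ennreal"
    and q :: "'ph \<Rightarrow> 'x \<Rightarrow> 'z \<Rightarrow> ennreal"
    and xt :: "'x \<times> 'y \<Rightarrow> 't"
    and lik :: "'th \<Rightarrow> 'z \<Rightarrow> 't \<Rightarrow> ennreal"
    and c :: "'ps \<Rightarrow> 'y \<Rightarrow> 'z \<Rightarrow> ennreal"
    and \<theta> :: 'th and \<phi> :: 'ph
  assumes "cond_vae MX MY MZ MT ref \<Theta> \<Phi> pdata prior dec q xt lik"
    and "\<And>\<psi>. \<psi> \<in> \<Psi> \<Longrightarrow> cond_density MY MZ (c \<psi>)"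
    and "\<theta> \<in> \<Theta>" and "\<phi> \<in> \<Phi>"
    and "abs_integrable (r_joint MZ pdata (q \<phi>))
      (\<lambda>((x, y), z). eln (lik \<theta> z (xt (x, y)) * r_cond MY MZ pdata (q \<phi>) y z / q \<phi> x z))"
  shows "{\<psi>. is_arg_max (\<lambda>\<psi>. O_for MZ pdata xt (lik \<theta>) (q \<phi>) (c \<psi>)) (\<lambda>\<psi>. \<psi> \<in> \<Psi>) \<psi>} =
    {\<psi>. is_arg_min
       (\<lambda>\<psi>. expect (pdata_y MY pdata) (\<lambda>y. KL MZ (r_cond MY MZ pdata (q \<phi>) y) (c \<psi> y)))
       (\<lambda>\<psi>. \<psi> \<in> \<Psi>) \<psi>}"
proof -
  interpret cond_vae MX MY MZ MT ref \<Theta> \<Phi> pdata prior dec q xt lik by fact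
  let ?R = "r_joint MZ pdata (q \<phi>)"
  let ?A = "\<lambda>((x, y), z). eln (lik \<theta> z (xt (x, y)) * r_cond MY MZ pdata (q \<phi>) y z / q \<phi> x z)"
  have fin: "\<bar>expect ?R ?A\<bar> \<noteq> \<infinity>"
    using abs_integrable_parts(1,2)[OF assms(5)] unfolding expect_def
    by (cases "\<integral>\<^sup>+ w. e2ennreal (?A w) \<partial>?R"; cases "\<integral>\<^sup>+ w. e2ennreal (- ?A w) \<partial>?R")
      (auto simp: enn2ereal_ennreal)
  \<comment> \<open>The identity is available on \<open>\<Psi>\<close> only, which is enough because
    competitors in both optimisations also range over \<open>\<Psi>\<close>.\<close>
  have "O_for MZ pdata xt (lik \<theta>) (q \<phi>) (c \<psi>) = expect ?R ?A -
      expect (pdata_y MY pdata) (\<lambda>y. KL MZ (r_cond MY MZ pdata (q \<phi>) y) (c \<psi> y))"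
    if "\<psi> \<in> \<Psi>" for \<psi>
    using assms(2)[OF that] assms(3-5) by (rule O_for_eq_diff)
  then show ?thesis
    by (auto simp: is_arg_max_def is_arg_min_def ereal_diff_less_cancel_left[OF fin])
qed

end
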